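(* Let $m \ge 2$ be an integer and let $n = 2^{m-2}+1$. Let the input distribution be uniform, i.e. $\Pi = \mathrm{diag}\left(\frac1n,\ldots,\frac1n\right) \in \mathbb{R}^{n\times n}$. Then there is no subset $\mathcal{U} \subseteq \mathbb{R}^{n \times m}$ of utility matrices such that for every two channels $C, \bar C \in \mathbb{R}^{m \times n}$ the equivalence \[ C \trianglerighteq_S \bar C \quad \Longleftrightarrow \quad C \succcurlyeq_B^{\mathcal{U}} \bar C \] holds. In other words, the Shannon-order and the reduced Blackwell-usefulness with respect to $\mathcal{U}$ are not equivalent for any $\mathcal{U} \subseteq \mathbb{R}^{n\times m}$.
   Context: A (real) matrix is called stochastic if it is column stochastic: all entries are nonnegative and each column sums to $1$. A channel is a stochastic matrix $C \in \mathbb{R}^{m \times n}$ ($m$ = length of the output alphabet, $n$ = length of the input alphabet). A utility matrix is an arbitrary matrix $U \in \mathbb{R}^{n\times m}$. The policy space of a channel $C \in \mathbb{R}^{m\times n}$ is $\Phi(C) = \{ D \in \mathbb{R}^{m\times n} \mid D = A\cdot C \text{ for some stochastic } A \in \mathbb{R}^{m\times m}\}$. Shannon-order: $C \trianglerighteq_S \bar C$ means that there exist stochastic matrices $M \in \mathbb{R}^{m\times m}$ and $N \in \mathbb{R}^{n \times n}$ with $\bar C = M \cdot C\cdot N$. Reduced Blackwell-usefulness: for a subset $\mathcal{U} \subseteq \mathbb{R}^{n\times m}$ and a diagonal matrix $\Pi\in\mathbb{R}^{n\times n}$ storing the input distribution, $C \succcurlyeq_B^{\mathcal{U}} \bar C$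 means that for all $U \in \mathcal{U}$ \[ \max_{D \in \Phi(C)} \mathrm{tr}(U\cdot D\cdot \Pi) \ \ge\ \max_{D \in \Phi(\bar C)} \mathrm{tr}(U\cdot D\cdot \Pi). \] *)

theory Defs
  imports Complex_Main "Jordan_Normal_Form.Matrix"
begin

definition stochastic :: "real mat \<Rightarrow> bool" where
  "stochastic A \<longleftrightarrow>
     (\<forall>i<dim_row A. \<forall>j<dim_col A. 0 \<le> A $$ (i, j)) \<and>
     (\<forall>j<dim_col A. (\<Sum>i<dim_row A. A $$ (i, j)) = 1)"

definition channel :: "nat \<Rightarrow> nat \<Rightarrow> real mat \<Rightarrow> bool" where
  "channel m n C \<longleftrightarrow> C \<in> carrier_mat m n \<and> stochastic C"

definition mat_trace :: "real mat \<Rightarrow> real" where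
  "mat_trace A = (\<Sum>i<dim_row A. A $$ (i, i))"

definition policy_space :: "real mat \<Rightarrow> real mat set" where
  "policy_space C =
     {A * C | A. A \<in> carrier_mat (dim_row C) (dim_row C) \<and> stochastic A}"

definition shannon_ge :: "real mat \<Rightarrow> real mat \<Rightarrow> bool" where
  "shannon_ge C C' \<longleftrightarrow>
     (\<exists>M N. M \<in> carrier_mat (dim_row C) (dim_row C) \<and> stochastic M \<and>
            N \<in> carrier_mat (dim_col C) (dim_col C) \<and> stochastic N \<and>
            C' = M * C * N)"

(* The maximum of tr (U D Pi) over D in the policy space is written as a supremum;
   max_utility_attained below shows that it is a genuine maximum. *)
definition max_utility :: "real mat \<Rightarrow> real mat \<Rightarrow> real mat \<Rightarrow> real" where
  "max_utility P U C = (SUP D\<in>policy_space C. mat_trace (U * D * P))"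

definition blackwell_ge :: "real mat \<Rightarrow> real mat set \<Rightarrow> real mat \<Rightarrow> real mat \<Rightarrow> bool" where
  "blackwell_ge P \<U> C C' \<longleftrightarrow> (\<forall>U\<in>\<U>. max_utility P U C' \<le> max_utility P U C)"

lemma mat_trace_comm:
  assumes "A \<in> carrier_mat k l" "B \<in> carrier_mat l k"
  shows "mat_trace (A * B) = mat_trace (B * A)"
proof -
  have "mat_trace (A * B) = (\<Sum>i<k. \<Sum>j<l. A $$ (i, j) * B $$ (j, i))"
    using assms by (auto simp: mat_trace_def scalar_prod_def lessThan_atLeast0 intro!: sum.cong)
  also have "\<dots> = (\<Sum>j<l. \<Sum>i<k. B $$ (j, i) * A $$ (i, j))"
    by (subst sum.swap) (simp add: mult.commute)
  also have "\<dots> = mat_trace (B * A)"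
    using assms by (auto simp: mat_trace_def scalar_prod_def lessThan_atLeast0 intro!: sum.cong)
  finally show ?thesis .
qed

lemma max_utility_attained:
  assumes m: "0 < m" and C: "C \<in> carrier_mat m n"
    and U: "U \<in> carrier_mat n m" and P: "P \<in> carrier_mat n n"
  shows "\<exists>D\<in>policy_space C. max_utility P U C = mat_trace (U * D * P) \<and>
           (\<forall>D'\<in>policy_space C. mat_trace (U * D' * P) \<le> mat_trace (U * D * P))"
proof -
  define W where "W = C * P * U"
  have W: "W \<in> carrier_mat m m" using C U P by (auto simp: W_def)
  have tr: "mat_trace (U * (A * C) * P) = (\<Sum>k<m. \<Sum>i<m. W $$ (k, i) * A $$ (i, k))"
    if A: "A \<in> carrier_mat m m" for A
  proof -
    have AC: "A * C \<in> carrier_mat m n" using A C by auto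
    have CP: "C * P \<in> carrier_mat m n" using C P by auto
    have "U * (A * C) * P = (U * A) * (C * P)"
      using assoc_mult_mat[OF U A C] assoc_mult_mat[OF _ C P, of "U * A" n] U A by auto
    then have "mat_trace (U * (A * C) * P) = mat_trace ((C * P) * (U * A))"
      using mat_trace_comm[of "U * A" n m "C * P"] U A CP by auto
    also have "(C * P) * (U * A) = W * A"
      using assoc_mult_mat[OF CP U A] by (simp add: W_def)
    also have "mat_trace (W * A) = (\<Sum>k<m. \<Sum>i<m. W $$ (k, i) * A $$ (i, k))"
      using W A by (auto simp: mat_trace_def scalar_prod_def lessThan_atLeast0 intro!: sum.cong)
    finally show ?thesis .
  qed
  have "\<exists>j<m. \<forall>i<m. W $$ (k, i) \<le> W $$ (k, j)" for k
  proof -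
    have fin: "finite ((\<lambda>i. W $$ (k, i)) ` {..<m})" "(\<lambda>i. W $$ (k, i)) ` {..<m} \<noteq> {}"
      using m by auto
    from Max_in[OF fin] Max_ge[OF fin(1)] show ?thesis by fastforce
  qed
  then obtain b where b: "\<And>k. b k < m" "\<And>k i. i < m \<Longrightarrow> W $$ (k, i) \<le> W $$ (k, b k)"
    by metis
  define A where "A = mat m m (\<lambda>(i, k). if i = b k then 1 else (0::real))"
  have A: "A \<in> carrier_mat m m" and sA: "stochastic A"
    using b(1) by (auto simp: A_def stochastic_def sum.delta)
  have opt: "mat_trace (U * (A * C) * P) = (\<Sum>k<m. W $$ (k, b k))"
    unfolding tr[OF A]
  proof (rule sum.cong[OF refl])
    fix k assume "k \<in> {..<m}"
    then have "(\<Sum>i<m. W $$ (k, i) * A $$ (i, k)) = (\<Sum>i<m. if i = b k then W $$ (k, i) else 0)"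
      by (intro sum.cong) (auto simp: A_def)
    also have "\<dots> = W $$ (k, b k)"
      using b(1)[of k] by (simp add: sum.delta)
    finally show "(\<Sum>i<m. W $$ (k, i) * A $$ (i, k)) = W $$ (k, b k)" .
  qed
  have AC: "A * C \<in> policy_space C" using A sA C by (auto simp: policy_space_def)
  have le: "mat_trace (U * D * P) \<le> mat_trace (U * (A * C) * P)" if "D \<in> policy_space C" for D
  proof -
    from that C obtain B where B: "B \<in> carrier_mat m m" "stochastic B" and D: "D = B * C"
      by (auto simp: policy_space_def)
    have "(\<Sum>i<m. W $$ (k, i) * B $$ (i, k)) \<le> W $$ (k, b k)" if "k < m" for k
    proof -
      have "(\<Sum>i<m. W $$ (k, i) * B $$ (i, k)) \<le> (\<Sum>i<m. W $$ (k, b k) * B $$ (i, k))"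
        using B b(2) that by (intro sum_mono mult_right_mono) (auto simp: stochastic_def)
      also have "\<dots> = W $$ (k, b k) * (\<Sum>i<m. B $$ (i, k))" by (simp add: sum_distrib_left)
      also have "(\<Sum>i<m. B $$ (i, k)) = 1" using B that by (auto simp: stochastic_def)
      finally show ?thesis by simp
    qed
    then show ?thesis unfolding D tr[OF B(1)] opt by (auto intro: sum_mono)
  qed
  have "max_utility P U C = mat_trace (U * (A * C) * P)"
    unfolding max_utility_def using AC le by (intro cSup_eq_maximum) auto
  then show ?thesis using AC le by blast
qed

end

theory Submission
  imports Defs
begin

text \<open>
  For fixed \<open>U\<close> the maximal utility is the support function of the policy space, hence convex in the
  channel, so \<open>{C'. blackwell_ge P \<U> C C'}\<close> is a convex set for every \<open>\<U>\<close>. The set of channels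
  Shannon-dominated by \<open>C\<close> is not: take for \<open>C\<close> the Z-channel that sends the input \<open>0\<close> to the
  output \<open>0\<close> and every other input to \<open>0\<close> or \<open>1\<close> with probability \<open>1/2\<close>. Relabelling inputs and
  outputs gives a Z-channel \<open>C'\<close> with the roles of \<open>0\<close> and \<open>1\<close> exchanged, and the average of \<open>C\<close> and
  \<open>C'\<close> is a binary symmetric channel with error \<open>1/4\<close>, which \<open>C\<close> does not dominate. This works for
  all alphabets with at least two letters.
\<close>

lemma mat_trace_convex_comb:
  assumes "A \<in> carrier_mat k k" "B \<in> carrier_mat k k"
  shows "mat_trace (a \<cdot>\<^sub>m A + b \<cdot>\<^sub>m B) = a * mat_trace A + b * mat_trace B"
  using assms by (auto simp: mat_trace_def sum.distrib sum_distrib_left)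

text \<open>A policy that is optimal for the mixture is given by one stochastic matrix
  \<open>A\<close>. The same \<open>A\<close> yields a policy for \<open>C1\<close> and one for
  \<open>C2\<close>, each worth at most \<open>max_utility P U C\<close>. The trace is linear in the
  channel, so the value of the mixture is the average of these two values.\<close>

lemma blackwell_ge_convex:
  assumes m: "0 < m" and t: "0 \<le> t" "t \<le> 1"
    and C1: "C1 \<in> carrier_mat m n" and C2: "C2 \<in> carrier_mat m n"
    and \<U>: "\<U> \<subseteq> carrier_mat n m" and P: "P \<in> carrier_mat n n"
    and ge: "blackwell_ge P \<U> C C1" "blackwell_ge P \<U> C C2"
  shows "blackwell_ge P \<U> C (t \<cdot>\<^sub>m C1 + (1 - t) \<cdot>\<^sub>m C2)"
  unfolding blackwell_ge_def
proof
  fix U assume "U \<in> \<U>"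
  then have U: "U \<in> carrier_mat n m" using \<U> by auto
  let ?B = "t \<cdot>\<^sub>m C1 + (1 - t) \<cdot>\<^sub>m C2"
  have B: "?B \<in> carrier_mat m n" using C1 C2 by auto
  obtain D where D: "D \<in> policy_space ?B" and maxB: "max_utility P U ?B = mat_trace (U * D * P)"
    using max_utility_attained[OF m B U P] by blast
  then obtain A where A: "A \<in> carrier_mat m m" "stochastic A" and DA: "D = A * ?B"
    using B by (auto simp: policy_space_def)
  have bound: "mat_trace (U * (A * K) * P) \<le> max_utility P U C"
    if K: "K \<in> carrier_mat m n" "blackwell_ge P \<U> C K" for K
  proof -
    have "A * K \<in> policy_space K" using A K by (auto simp: policy_space_def)
    then have "mat_trace (U * (A * K) * P) \<le> max_utility P U K"
      using max_utility_attained[OF m K(1) U P] by force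
    also have "\<dots> \<le> max_utility P U C"
      using K(2) \<open>U \<in> \<U>\<close> by (auto simp: blackwell_ge_def)
    finally show ?thesis .
  qed
  have c: "A * C1 \<in> carrier_mat m n" "A * C2 \<in> carrier_mat m n"
    "U * (A * C1) \<in> carrier_mat n n" "U * (A * C2) \<in> carrier_mat n n"
    using A C1 C2 U by auto
  have "A * ?B = t \<cdot>\<^sub>m (A * C1) + (1 - t) \<cdot>\<^sub>m (A * C2)"
    using A C1 C2 by (simp add: mult_add_distrib_mat[of _ m m _ n] mult_smult_distrib)
  also have "U * \<dots> = t \<cdot>\<^sub>m (U * (A * C1)) + (1 - t) \<cdot>\<^sub>m (U * (A * C2))"
    using c U by (simp add: mult_add_distrib_mat[of _ n m _ n] mult_smult_distrib)
  also have "\<dots> * P = t \<cdot>\<^sub>m (U * (A * C1) * P) + (1 - t) \<cdot>\<^sub>m (U * (A * C2) * P)"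
    using c P by (simp add: add_mult_distrib_mat[of _ n n _ _ n] mult_smult_assoc_mat)
  finally have "mat_trace (U * D * P)
      = t * mat_trace (U * (A * C1) * P) + (1 - t) * mat_trace (U * (A * C2) * P)"
    unfolding DA using c P by (simp add: mat_trace_convex_comb[of _ n])
  also have "\<dots> \<le> t * max_utility P U C + (1 - t) * max_utility P U C"
    using bound[OF C1 ge(1)] bound[OF C2 ge(2)] t by (intro add_mono mult_left_mono) auto
  finally show "max_utility P U ?B \<le> max_utility P U C"
    by (simp add: maxB algebra_simps)
qed

lemma channel_convex:
  assumes "0 \<le> t" "t \<le> 1" and "channel m n C1" "channel m n C2"
  shows "channel m n (t \<cdot>\<^sub>m C1 + (1 - t) \<cdot>\<^sub>m C2)"
proof -
  have C: "C1 \<in> carrier_mat m n" "C2 \<in> carrier_mat m n"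
    using assms by (auto simp: channel_def)
  note [simp] = carrier_matD[OF C(1)] carrier_matD[OF C(2)]
  show ?thesis
    using assms C
    by (auto simp: channel_def stochastic_def sum.distrib simp flip: sum_distrib_left)
qed

text \<open>Outputs from 2 on have probability 0 and all inputs other than 0 share one column, which
  embeds the binary Z-channel into larger alphabets.\<close>

definition z_channel :: "nat \<Rightarrow> nat \<Rightarrow> real mat" where
  "z_channel m n = mat m n (\<lambda>(i, j).
     if j = 0 then of_bool (i = 0) else of_bool (i < 2) / 2)"

definition z_channel' :: "nat \<Rightarrow> nat \<Rightarrow> real mat" where
  "z_channel' m n = mat m n (\<lambda>(i, j).
     if j = 0 then of_bool (i < 2) / 2 else of_bool (i = 1))"

lemma z_channel_carrier [simp]:
  "z_channel m n \<in> carrier_mat m n" "z_channel' m n \<in> carrier_mat m n"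
  by (auto simp: z_channel_def z_channel'_def)

lemma sum_two_point:
  fixes f :: "nat \<Rightarrow> real"
  assumes "2 \<le> m" and "\<And>i. 2 \<le> i \<Longrightarrow> i < m \<Longrightarrow> f i = 0"
  shows "(\<Sum>i<m. f i) = f 0 + f 1"
proof -
  have "(\<Sum>i<m. f i) = (\<Sum>i\<in>{0, 1}. f i)"
    using assms by (intro sum.mono_neutral_right) (auto simp: not_less_eq)
  then show ?thesis by simp
qed

lemma channel_z_channel:
  assumes "2 \<le> m"
  shows "channel m n (z_channel m n)" "channel m n (z_channel' m n)"
  using assms
  by (auto simp: channel_def stochastic_def z_channel_def z_channel'_def sum_two_point[OF assms])

text \<open>As the columns of all nonzero inputs coincide, \<open>N\<close> matters only through the
  weight \<open>N $$ (0, j)\<close> that it puts on input 0; the remaining weight goes to a column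
  with value \<open>(?a + ?b) / 2\<close>.\<close>

lemma index_mult_z_channel_mult:
  assumes m: "2 \<le> m"
    and M: "M \<in> carrier_mat m m" and N: "N \<in> carrier_mat n n" "stochastic N"
    and ij: "i < m" "j < n"
  shows "(M * z_channel m n * N) $$ (i, j)
    = (M $$ (i, 0) * (1 + N $$ (0, j)) + M $$ (i, 1) * (1 - N $$ (0, j))) / 2"
proof -
  let ?a = "M $$ (i, 0)" and ?b = "M $$ (i, 1)"
  have MC: "(M * z_channel m n) $$ (i, k) = (if k = 0 then ?a else (?a + ?b) / 2)" if "k < n" for k
  proof -
    have "(M * z_channel m n) $$ (i, k) = (\<Sum>l<m. M $$ (i, l) * z_channel m n $$ (l, k))"
      using M ij that by (simp add: scalar_prod_def lessThan_atLeast0 z_channel_def)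
    also have "\<dots> = (if k = 0 then ?a else (?a + ?b) / 2)"
      using m that by (subst sum_two_point[OF m]) (auto simp: z_channel_def)
    finally show ?thesis .
  qed
  have "(M * z_channel m n * N) $$ (i, j) = (\<Sum>k<n. (M * z_channel m n) $$ (i, k) * N $$ (k, j))"
    using M N ij by (simp add: scalar_prod_def lessThan_atLeast0 z_channel_def)
  \<comment> \<open>A constant value plus a correction at input 0: the constant part then meets the
    column sum of \<open>N\<close>, which is 1.\<close>
  also have "\<dots> = (\<Sum>k<n. (?a + ?b) / 2 * N $$ (k, j)
      + (if k = 0 then (?a - ?b) / 2 * N $$ (k, j) else 0))"
    by (intro sum.cong refl) (auto simp: MC field_simps)
  also have "\<dots> = (?a + ?b) / 2 * (\<Sum>k<n. N $$ (k, j)) + (?a - ?b) / 2 * N $$ (0, j)"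
    using ij by (simp add: sum.distrib sum_distrib_left)
  also have "(\<Sum>k<n. N $$ (k, j)) = 1"
    using N ij by (auto simp: stochastic_def)
  finally show ?thesis by (simp add: field_simps)
qed

lemma shannon_ge_refl: "shannon_ge C C"
proof -
  have "stochastic (1\<^sub>m k)" for k
    by (auto simp: stochastic_def)
  moreover have "C = 1\<^sub>m (dim_row C) * C * 1\<^sub>m (dim_col C)" by simp
  ultimately show ?thesis unfolding shannon_ge_def by (metis one_carrier_mat)
qed

lemma shannon_ge_z_channel':
  assumes m: "2 \<le> m" and n: "2 \<le> n"
  shows "shannon_ge (z_channel m n) (z_channel' m n)"
proof -
  \<comment> \<open>\<open>M\<close> swaps the outputs 0 and 1. \<open>N\<close> replaces input 0 by
    input 1, a noisy one, and every other input by 0, the noiseless one.\<close>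
  define M :: "real mat" where
    "M = mat m m (\<lambda>(i, j). of_bool (i = (if j = 0 then 1 else if j = 1 then 0 else j)))"
  define N :: "real mat" where
    "N = mat n n (\<lambda>(i, j). of_bool (i = (if j = 0 then 1 else 0)))"
  have M: "M \<in> carrier_mat m m" "stochastic M"
    using m by (auto simp: M_def stochastic_def of_bool_def)
  have N: "N \<in> carrier_mat n n" "stochastic N"
    using n by (auto simp: N_def stochastic_def of_bool_def)
  have "z_channel' m n = M * z_channel m n * N"
  proof (rule eq_matI)
    fix i j assume "i < dim_row (M * z_channel m n * N)" "j < dim_col (M * z_channel m n * N)"
    then have ij: "i < m" "j < n" using M N by auto
    show "z_channel' m n $$ (i, j) = (M * z_channel m n * N) $$ (i, j)"
      unfolding index_mult_z_channel_mult[OF m M(1) N ij]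
      using ij m n by (auto simp: z_channel'_def M_def N_def)
  qed (use M N in \<open>auto simp: z_channel'_def\<close>)
  then show ?thesis
    using M N unfolding shannon_ge_def by (auto simp: z_channel_def)
qed

lemma stochastic_le_1:
  assumes "stochastic A" "i < dim_row A" "j < dim_col A"
  shows "A $$ (i, j) \<le> 1"
proof -
  have "A $$ (i, j) \<le> (\<Sum>i<dim_row A. A $$ (i, j))"
    using assms by (intro member_le_sum) (auto simp: stochastic_def)
  then show ?thesis using assms by (simp add: stochastic_def)
qed

text \<open>The difference of the two equations is a product of two numbers of absolute value at
  most 1, yet equals 1. This forces all four variables to be 0 or 1, and then the left sides are
  integers.\<close>

lemma two_point_mixture_False:
  fixes a b s t :: real
  assumes "0 \<le> a" "a \<le> 1" "0 \<le> b" "b \<le> 1" "0 \<le> s" "s \<le> 1" "0 \<le> t" "t \<le> 1"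
    and eq: "a * (1 + s) + b * (1 - s) = 3 / 2" "a * (1 + t) + b * (1 - t) = 1 / 2"
  shows False
proof -
  have prod: "(a - b) * (s - t) = 1"
    using eq by (simp add: algebra_simps)
  then have "\<bar>a - b\<bar> * \<bar>s - t\<bar> = 1" by (simp flip: abs_mult)
  moreover have "\<bar>a - b\<bar> * \<bar>s - t\<bar> \<le> \<bar>a - b\<bar>" "\<bar>a - b\<bar> * \<bar>s - t\<bar> \<le> \<bar>s - t\<bar>"
    using assms by (auto intro!: mult_left_le mult_left_le_one_le)
  ultimately have "1 \<le> \<bar>a - b\<bar>" "1 \<le> \<bar>s - t\<bar>" by simp_all
  then have "(a = 1 \<and> b = 0 \<or> a = 0 \<and> b = 1) \<and> (s = 1 \<and> t = 0 \<or> s = 0 \<and> t = 1)"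
    using assms(1-8) by linarith
  then show False using eq by auto
qed

text \<open>It suffices to look at output 0 under the inputs 0 and 1. The entries 3/4 and 1/4 of the
  mixture, doubled, are the right sides in \<open>two_point_mixture_False\<close>.\<close>

lemma not_shannon_ge_symmetric_channel:
  assumes m: "2 \<le> m" and n: "2 \<le> n"
  shows "\<not> shannon_ge (z_channel m n) ((1/2) \<cdot>\<^sub>m z_channel m n + (1/2) \<cdot>\<^sub>m z_channel' m n)"
    (is "\<not> shannon_ge _ ?B")
proof
  assume "shannon_ge (z_channel m n) ?B"
  then obtain M N where M: "M \<in> carrier_mat m m" "stochastic M"
    and N: "N \<in> carrier_mat n n" "stochastic N" and B: "?B = M * z_channel m n * N"
    by (auto simp: shannon_ge_def z_channel_def)
  have B0: "?B $$ (0, j) = (M $$ (0, 0) * (1 + N $$ (0, j)) + M $$ (0, 1) * (1 - N $$ (0, j))) / 2"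
    if "j < n" for j
    unfolding B using index_mult_z_channel_mult[OF m M(1) N _ that, of 0] m by simp
  have "?B $$ (0, 0) = 3 / 4" "?B $$ (0, 1) = 1 / 4"
    using m n by (auto simp: z_channel_def z_channel'_def)
  then show False
    using two_point_mixture_False[of "M $$ (0, 0)" "M $$ (0, 1)" "N $$ (0, 0)" "N $$ (0, 1)"]
      B0[of 0] B0[of 1] M N m n
    by (auto simp: stochastic_le_1 stochastic_def)
qed

theorem theorem1:
  fixes m n :: nat and P :: "real mat"
  assumes "m \<ge> 2" and "n = 2 ^ (m - 2) + 1"
    and "P = mat_diag n (\<lambda>i. 1 / real n)"
  shows "\<not> (\<exists>\<U> \<subseteq> carrier_mat n m. \<forall>C C'. channel m n C \<longrightarrow> channel m n C' \<longrightarrow>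
           (shannon_ge C C' \<longleftrightarrow> blackwell_ge P \<U> C C'))"
proof
  assume "\<exists>\<U> \<subseteq> carrier_mat n m. \<forall>C C'. channel m n C \<longrightarrow> channel m n C' \<longrightarrow>
           (shannon_ge C C' \<longleftrightarrow> blackwell_ge P \<U> C C')"
  then obtain \<U> where \<U>: "\<U> \<subseteq> carrier_mat n m"
    and eqv: "\<And>C C'. channel m n C \<Longrightarrow> channel m n C' \<Longrightarrow>
           shannon_ge C C' \<longleftrightarrow> blackwell_ge P \<U> C C'"
    by blast
  have m: "2 \<le> m" and n: "2 \<le> n" and P: "P \<in> carrier_mat n n"
    using assms by (auto simp: mat_diag_def)
  let ?Z = "z_channel m n" and ?Z' = "z_channel' m n"
  let ?B = "(1/2) \<cdot>\<^sub>m ?Z + (1/2) \<cdot>\<^sub>m ?Z'"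
  note ch = channel_z_channel[OF m, of n]
  have "channel m n ?B"
    using channel_convex[OF _ _ ch, of "1/2"] by simp
  \<comment> \<open>The equivalence is used in both directions: here to pass to the convex side, and
    after averaging to return to the Shannon-order.\<close>
  moreover have "blackwell_ge P \<U> ?Z ?Z" "blackwell_ge P \<U> ?Z ?Z'"
    using eqv ch shannon_ge_refl shannon_ge_z_channel'[OF m n] by blast+
  then have "blackwell_ge P \<U> ?Z ?B"
    using blackwell_ge_convex[of m "1/2" ?Z n ?Z' \<U> P ?Z] m \<U> P by simp
  ultimately have "shannon_ge ?Z ?B" using eqv ch by blast
  then show False using not_shannon_ge_symmetric_channel[OF m n] by blast
qed

end
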